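(* Let $\mathcal H$ be a real Hilbert space, let $\Phi:\mathcal H\to\mathbb R$ be convex and differentiable, with gradient $\nabla\Phi$ Lipschitz continuous on bounded sets and $\operatorname{argmin}\Phi\neq\emptyset$. Let $t_0>0$, $\alpha>0$, let $g:[t_0,+\infty[\to\mathcal H$ be locally integrable, and let $x:[t_0,+\infty[\to\mathcal H$ be a solution of $$\ddot x(t)+\frac{\alpha}{t}\dot x(t)+\nabla\Phi(x(t))=g(t).$$ Let $p=\min\left(1,\frac{\alpha}{3}\right)$ and suppose that $\int_{t_0}^{+\infty}t^p\|g(t)\|\,dt<+\infty$. Then $$\Phi(x(t))-\min\Phi=\mathcal O\left(\frac{1}{t^{2p}}\right)\quad\text{as }t\to+\infty .$$
   Context: $\operatorname{argmin}\Phi$ is the set of minimizers of $\Phi$ on $\mathcal H$. Since $g$ is only locally integrable, a solution is a continuously differentiable function $x$ with $\dot x$ locally absolutely continuous that satisfies the equation for almost every $t\ge t_0$. *)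

theory Defs
  imports "HOL-Analysis.Analysis" "HOL-Library.Landau_Symbols"
begin

definition argmin :: "('a \<Rightarrow> real) \<Rightarrow> 'a set" where
  "argmin \<Phi> = {z. is_arg_min \<Phi> (\<lambda>_. True) z}"

(* The minimum as the least element of the range.  It is a junk value when argmin \<Phi> is empty. *)
definition min_value :: "('a \<Rightarrow> real) \<Rightarrow> real" where
  "min_value \<Phi> = (LEAST m. m \<in> range \<Phi>)"

(* The library's integrable is restricted to second countable codomains, which would
   exclude non-separable Hilbert spaces.  This is the usual definition of Bochner
   integrability by approximation with integrable simple functions. *)
definition bochner_integrable :: "'b measure \<Rightarrow> ('b \<Rightarrow> 'a::real_normed_vector) \<Rightarrow> bool" where
  "bochner_integrable M f \<longleftrightarrow>
     (\<exists>s. (\<forall>i. Bochner_Integration.simple_bochner_integrable M (s i)) \<and>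
          (AE x in M. (\<lambda>i. s i x) \<longlonglongrightarrow> f x) \<and>
          (\<lambda>i. \<integral>\<^sup>+x. ennreal (norm (f x - s i x)) \<partial>M) \<longlonglongrightarrow> 0)"

definition locally_integrable_on :: "(real \<Rightarrow> 'a::real_normed_vector) \<Rightarrow> real set \<Rightarrow> bool" where
  "locally_integrable_on f S \<longleftrightarrow>
     (\<forall>a b. {a..b} \<subseteq> S \<longrightarrow> bochner_integrable (lebesgue_on {a..b}) f)"

(* A pair (u, v) in I stands for the interval from u to v; the intervals may share endpoints. *)
definition abs_continuous_on :: "(real \<Rightarrow> 'a::real_normed_vector) \<Rightarrow> real \<Rightarrow> real \<Rightarrow> bool" where
  "abs_continuous_on f a b \<longleftrightarrow>
     (\<forall>e>0. \<exists>d>0. \<forall>I::(real \<times> real) set.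
        finite I \<longrightarrow>
        (\<forall>(u, v)\<in>I. a \<le> u \<and> u \<le> v \<and> v \<le> b) \<longrightarrow>
        disjoint_family_on (\<lambda>(u, v). {u<..<v}) I \<longrightarrow>
        (\<Sum>(u, v)\<in>I. v - u) < d \<longrightarrow>
        (\<Sum>(u, v)\<in>I. norm (f v - f u)) < e)"

definition locally_abs_continuous_on :: "(real \<Rightarrow> 'a::real_normed_vector) \<Rightarrow> real set \<Rightarrow> bool" where
  "locally_abs_continuous_on f S \<longleftrightarrow> (\<forall>a b. {a..b} \<subseteq> S \<longrightarrow> abs_continuous_on f a b)"

(* Functions on [t0, \<infinity>[ are total functions whose values below t0 are irrelevant:
   all derivatives are taken within {t0..}, so they are one-sided at t0.
   Here G is the gradient field, v the velocity and w the acceleration at t. *)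
definition is_solution ::
  "('a::real_inner \<Rightarrow> 'a) \<Rightarrow> real \<Rightarrow> (real \<Rightarrow> 'a) \<Rightarrow> real \<Rightarrow> (real \<Rightarrow> 'a) \<Rightarrow> bool" where
  "is_solution G \<alpha> g t0 x \<longleftrightarrow>
     (\<exists>v. (\<forall>t\<ge>t0. (x has_vector_derivative v t) (at t within {t0..})) \<and>
          continuous_on {t0..} v \<and>
          locally_abs_continuous_on v {t0..} \<and>
          (AE t in lebesgue. t \<ge> t0 \<longrightarrow>
             (\<exists>w. (v has_vector_derivative w) (at t within {t0..}) \<and>
                  w + (\<alpha> / t) *\<^sub>R v t + G (x t) = g t)))"

end

theory Submission
  imports Defs
begin

text \<open>
  The proof is a Lyapunov argument. Fix a minimizer \<open>z\<close> of \<open>\<Phi>\<close>, let \<open>v\<close> be the velocity of the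
  solution \<open>x\<close>, and consider
  \[ E(t) = 2 t^{2p} (\Phi(x(t)) - \Phi(z)) + c\, t^{2p-2} \|x(t) - z\|^2 + \|u(t)\|^2, \qquad
     u(t) = 2p\, t^{p-1} (x(t) - z) + t^p v(t), \]
  where \<open>c = 2p(\<alpha> + 1 - 4p)\<close>. Differentiating along the equation, the cross terms in
  \<open>\<langle>x - z, v\<rangle>\<close> cancel because of the choice of \<open>c\<close>; convexity makes the terms in \<open>\<Phi>\<close>
  nonpositive because of the coefficient \<open>2p\<close> in \<open>u\<close>; the term in \<open>\<parallel>v\<parallel>\<^sup>2\<close> has the sign of
  \<open>3p - \<alpha>\<close> and the one in \<open>\<parallel>x - z\<parallel>\<^sup>2\<close> that of \<open>p - 1\<close>. The exponent \<open>p = min 1 (\<alpha>/3)\<close> is the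
  largest one for which both signs are right, and it also gives \<open>c \<ge> 0\<close>, so that \<open>E\<close>
  dominates each of its three terms. What remains is
  \<open>E' \<le> 2 \<langle>u, t\<^sup>p g\<rangle> \<le> 2 \<surd>E \<cdot> t\<^sup>p \<parallel>g\<parallel>\<close> (\<open>energy_dissipation\<close>, \<open>energy_derivative_le\<close>).

  Hence \<open>\<psi> = \<surd>(1 + E)\<close> satisfies \<open>\<psi>' \<le> t\<^sup>p \<parallel>g\<parallel>\<close> almost everywhere (\<open>sqrt_derivative_le\<close>; the
  summand 1 keeps the root differentiable where \<open>E\<close> vanishes). This replaces a Gronwall
  argument: the right-hand side no longer involves \<open>\<psi>\<close> and is integrable, so \<open>\<psi>\<close> is bounded, and
  then so is \<open>t\<^sup>2\<^sup>p (\<Phi>(x) - min \<Phi>)\<close>.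

  The passage from the bound on \<open>\<psi>'\<close> to one on the increments of \<open>\<psi>\<close> uses absolute continuity,
  as the derivative exists only almost everywhere. The function \<open>\<psi>\<close> is absolutely continuous
  because it is built from \<open>v\<close> and from continuously differentiable functions by operations
  that preserve this property, and \<open>abs_continuous_on_increment_le_integral\<close> does the rest.
\<close>

section \<open>Absolutely continuous curves\<close>

text \<open>
  The constant \<open>d\<close> of the definition as a rule: the nested quantifiers over finite families
  of intervals are hard for automatic instantiation.
\<close>

lemma abs_continuous_onE:
  assumes "abs_continuous_on f a b" "e > 0"
  obtains d where "d > 0"
    "\<And>I. finite I \<Longrightarrow> (\<forall>(u, v)\<in>I. a \<le> u \<and> u \<le> v \<and> v \<le> b) \<Longrightarrow>
       disjoint_family_on (\<lambda>(u, v). {u<..<v}) I \<Longrightarrow> (\<Sum>(u, v)\<in>I. v - u) < d \<Longrightarrow>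
       (\<Sum>(u, v)\<in>I. norm (f v - f u)) < e"
proof -
  note * = assms(1)[unfolded abs_continuous_on_def, THEN spec, THEN mp, OF assms(2)]
  from * show thesis
  proof (elim exE conjE)
    fix d assume d: "d > 0" and I: "\<forall>I. finite I \<longrightarrow> (\<forall>(u, v)\<in>I. a \<le> u \<and> u \<le> v \<and> v \<le> b) \<longrightarrow>
       disjoint_family_on (\<lambda>(u, v). {u<..<v}) I \<longrightarrow> (\<Sum>(u, v)\<in>I. v - u) < d \<longrightarrow>
       (\<Sum>(u, v)\<in>I. norm (f v - f u)) < e"
    show thesis
      by (rule that[OF d I[THEN spec, THEN mp, THEN mp, THEN mp, THEN mp]])
  qed
qed

text \<open>
  All the closure properties below come from this one: a function whose oscillation is
  controlled linearly by that of absolutely continuous functions inherits their modulus up to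
  the factor \<open>M\<close>. Comparison with the identity covers Lipschitz functions.
\<close>

lemma abs_continuous_on_combine:
  fixes f :: "real \<Rightarrow> 'b::real_normed_vector" and g :: "real \<Rightarrow> 'c::real_normed_vector"
    and h :: "real \<Rightarrow> 'd::real_normed_vector"
  assumes f: "abs_continuous_on f a b" and g: "abs_continuous_on g a b"
    and h: "\<And>s t. a \<le> s \<Longrightarrow> s \<le> t \<Longrightarrow> t \<le> b \<Longrightarrow>
               norm (h t - h s) \<le> K * norm (f t - f s) + L * norm (g t - g s)"
  shows "abs_continuous_on h a b"
  unfolding abs_continuous_on_def
proof (intro allI impI)
  fix e :: real assume e: "e > 0"
  define M where "M = \<bar>K\<bar> + \<bar>L\<bar> + 1"
  have M: "M > 0" "K \<le> M" "L \<le> M" unfolding M_def by linarith+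
  have e': "e / (2 * M) > 0" using e M by simp
  obtain d1 where d1: "d1 > 0" "\<And>I. finite I \<Longrightarrow> (\<forall>(u, v)\<in>I. a \<le> u \<and> u \<le> v \<and> v \<le> b) \<Longrightarrow>
        disjoint_family_on (\<lambda>(u, v). {u<..<v}) I \<Longrightarrow> (\<Sum>(u, v)\<in>I. v - u) < d1 \<Longrightarrow>
        (\<Sum>(u, v)\<in>I. norm (f v - f u)) < e / (2 * M)"
    by (rule abs_continuous_onE[OF f e']) (rule that)
  obtain d2 where d2: "d2 > 0" "\<And>I. finite I \<Longrightarrow> (\<forall>(u, v)\<in>I. a \<le> u \<and> u \<le> v \<and> v \<le> b) \<Longrightarrow>
        disjoint_family_on (\<lambda>(u, v). {u<..<v}) I \<Longrightarrow> (\<Sum>(u, v)\<in>I. v - u) < d2 \<Longrightarrow>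
        (\<Sum>(u, v)\<in>I. norm (g v - g u)) < e / (2 * M)"
    by (rule abs_continuous_onE[OF g e']) (rule that)
  show "\<exists>d>0. \<forall>I::(real \<times> real) set. finite I \<longrightarrow> (\<forall>(u, v)\<in>I. a \<le> u \<and> u \<le> v \<and> v \<le> b) \<longrightarrow>
        disjoint_family_on (\<lambda>(u, v). {u<..<v}) I \<longrightarrow> (\<Sum>(u, v)\<in>I. v - u) < d \<longrightarrow>
        (\<Sum>(u, v)\<in>I. norm (h v - h u)) < e"
  proof (intro exI[of _ "min d1 d2"] conjI allI impI)
    show "min d1 d2 > 0" using d1 d2 by simp
    fix I :: "(real \<times> real) set"
    assume I: "finite I" "\<forall>(u, v)\<in>I. a \<le> u \<and> u \<le> v \<and> v \<le> b"
      "disjoint_family_on (\<lambda>(u, v). {u<..<v}) I" "(\<Sum>(u, v)\<in>I. v - u) < min d1 d2"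
    have "(\<Sum>(u, v)\<in>I. norm (h v - h u))
        \<le> (\<Sum>(u, v)\<in>I. M * norm (f v - f u) + M * norm (g v - g u))"
    proof (rule sum_mono, clarify)
      fix u v assume "(u, v) \<in> I"
      with I(2) have "a \<le> u" "u \<le> v" "v \<le> b" by auto
      then have "norm (h v - h u) \<le> K * norm (f v - f u) + L * norm (g v - g u)"
        by (rule h)
      also have "\<dots> \<le> M * norm (f v - f u) + M * norm (g v - g u)"
        using M by (intro add_mono mult_right_mono) auto
      finally show "norm (h v - h u) \<le> M * norm (f v - f u) + M * norm (g v - g u)" .
    qed
    also have "\<dots> = M * (\<Sum>(u, v)\<in>I. norm (f v - f u)) + M * (\<Sum>(u, v)\<in>I. norm (g v - g u))"
      by (simp add: sum.distrib sum_distrib_left split_beta)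
    also have "\<dots> < M * (e / (2 * M)) + M * (e / (2 * M))"
      using d1(2)[OF I(1-3)] d2(2)[OF I(1-3)] I(4) M
      by (intro add_strict_mono mult_strict_left_mono) auto
    also have "\<dots> = e" using M by (simp add: field_simps)
    finally show "(\<Sum>(u, v)\<in>I. norm (h v - h u)) < e" .
  qed
qed

lemma abs_continuous_on_ident: "abs_continuous_on (\<lambda>t::real. t) a b"
  unfolding abs_continuous_on_def
proof (intro allI impI exI[of _ "e::real" for e] conjI)
  fix e :: real and I :: "(real \<times> real) set"
  assume "\<forall>(u, v)\<in>I. a \<le> u \<and> u \<le> v \<and> v \<le> b" "(\<Sum>(u, v)\<in>I. v - u) < e"
  moreover from this(1) have "(\<Sum>(u, v)\<in>I. norm (v - u)) = (\<Sum>(u, v)\<in>I. v - u)"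
    by (intro sum.cong) auto
  ultimately show "(\<Sum>(u, v)\<in>I. norm (v - u)) < e" by simp
qed

lemma abs_continuous_on_C1:
  fixes f :: "real \<Rightarrow> 'b::real_normed_vector"
  assumes f: "\<And>t. t \<in> {a..b} \<Longrightarrow> (f has_vector_derivative f' t) (at t within {a..b})"
    and f': "continuous_on {a..b} f'"
  shows "abs_continuous_on f a b"
proof -
  have "bounded (f' ` {a..b})"
    by (intro compact_imp_bounded compact_continuous_image f') auto
  then obtain B where B: "\<And>t. t \<in> {a..b} \<Longrightarrow> norm (f' t) \<le> B"
    unfolding bounded_iff by (metis imageI)
  show ?thesis
  proof (rule abs_continuous_on_combine[OF abs_continuous_on_ident abs_continuous_on_ident])
    fix s t assume st: "a \<le> s" "s \<le> t" "t \<le> b"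
    have "norm (f t - f s) \<le> B * norm (t - s)"
    proof (rule differentiable_bound[of "{a..b}"])
      fix r assume r: "r \<in> {a..b}"
      show "(f has_derivative (\<lambda>h. h *\<^sub>R f' r)) (at r within {a..b})"
        using f[OF r] by (simp add: has_vector_derivative_def)
      show "onorm (\<lambda>h. h *\<^sub>R f' r) \<le> B"
        using B[OF r] by (intro onorm_le) (simp add: mult.commute[of B] mult_left_mono)
    qed (use st in auto)
    then show "norm (f t - f s) \<le> B * norm (t - s) + 0 * norm (t - s)" by simp
  qed
qed

lemma abs_continuous_on_add:
  assumes "abs_continuous_on f a b" "abs_continuous_on g a b"
  shows "abs_continuous_on (\<lambda>t. f t + g t) a b"
proof (rule abs_continuous_on_combine[OF assms])
  fix s t
  have "f t + g t - (f s + g s) = (f t - f s) + (g t - g s)" by simp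
  then show "norm (f t + g t - (f s + g s)) \<le> 1 * norm (f t - f s) + 1 * norm (g t - g s)"
    by (metis mult_1 norm_triangle_ineq)
qed

text \<open>
  The factors are bounded on the compact interval, so the product rule for increments reduces
  to a linear bound.
\<close>

lemma (in bounded_bilinear) abs_continuous_on_prod:
  assumes f: "abs_continuous_on f a b" and g: "abs_continuous_on g a b"
    and cf: "continuous_on {a..b} f" and cg: "continuous_on {a..b} g"
  shows "abs_continuous_on (\<lambda>t. prod (f t) (g t)) a b"
proof -
  have "bounded (f ` {a..b})" "bounded (g ` {a..b})"
    by (intro compact_imp_bounded compact_continuous_image cf cg compact_Icc)+
  then obtain F G where "\<forall>y\<in>f ` {a..b}. norm y \<le> F" "\<forall>y\<in>g ` {a..b}. norm y \<le> G"
    unfolding bounded_iff by blast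
  then have F: "\<And>t. t \<in> {a..b} \<Longrightarrow> norm (f t) \<le> F"
    and G: "\<And>t. t \<in> {a..b} \<Longrightarrow> norm (g t) \<le> G"
    by blast+
  obtain K where K: "K \<ge> 0" "\<And>x y. norm (prod x y) \<le> norm x * norm y * K"
    using nonneg_bounded by blast
  show ?thesis
  proof (rule abs_continuous_on_combine[OF f g])
    fix s t assume st: "a \<le> s" "s \<le> t" "t \<le> b"
    have "prod (f t) (g t) - prod (f s) (g s) = prod (f t - f s) (g t) + prod (f s) (g t - g s)"
      by (simp add: diff_left diff_right)
    then have "norm (prod (f t) (g t) - prod (f s) (g s))
        \<le> norm (prod (f t - f s) (g t)) + norm (prod (f s) (g t - g s))"
      by (simp add: norm_triangle_ineq)
    also have "\<dots> \<le> norm (f t - f s) * norm (g t) * K + norm (f s) * norm (g t - g s) * K"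
      by (intro add_mono K)
    also have "\<dots> \<le> norm (f t - f s) * G * K + F * norm (g t - g s) * K"
      using F[of s] G[of t] st K(1) by (intro add_mono mult_right_mono mult_left_mono) auto
    finally show "norm (prod (f t) (g t) - prod (f s) (g s))
        \<le> (G * K) * norm (f t - f s) + (F * K) * norm (g t - g s)"
      by (simp add: mult_ac)
  qed
qed

text \<open>The lower bound 1 keeps the argument in a range on which the square root is Lipschitz.\<close>

lemma abs_continuous_on_sqrt:
  fixes f :: "real \<Rightarrow> real"
  assumes f: "abs_continuous_on f a b" and ge: "\<And>t. t \<in> {a..b} \<Longrightarrow> f t \<ge> 1"
  shows "abs_continuous_on (\<lambda>t. sqrt (f t)) a b"
proof (rule abs_continuous_on_combine[OF f f])
  fix s t assume st: "a \<le> s" "s \<le> t" "t \<le> b"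
  have 1: "f s \<ge> 1" "f t \<ge> 1" using ge[of s] ge[of t] st by simp_all
  then have "1 \<le> sqrt (f t) + sqrt (f s)"
    by (smt (verit) real_sqrt_ge_one)
  then have "\<bar>sqrt (f t) - sqrt (f s)\<bar> * 1 \<le> \<bar>sqrt (f t) - sqrt (f s)\<bar> * (sqrt (f t) + sqrt (f s))"
    by (intro mult_left_mono) auto
  also have "\<dots> = \<bar>(sqrt (f t) - sqrt (f s)) * (sqrt (f t) + sqrt (f s))\<bar>"
    using 1 by (simp add: abs_mult)
  also have "(sqrt (f t) - sqrt (f s)) * (sqrt (f t) + sqrt (f s)) = f t - f s"
    using 1 by (simp add: algebra_simps)
  finally show "norm (sqrt (f t) - sqrt (f s)) \<le> 1 * norm (f t - f s) + 0 * norm (f t - f s)"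
    by simp
qed

section \<open>Increments of absolutely continuous functions\<close>

text \<open>
  Absolute continuity in the language of gauge integration: the intervals of a partial tagged
  division that lie inside a set of small measure contribute little to the increment. Their
  total length is the measure of their union, hence less than \<open>d\<close>.
\<close>

lemma abs_continuous_on_tagged_sum:
  fixes f :: "real \<Rightarrow> real"
  assumes ac: "abs_continuous_on f a b" and e: "e > 0"
  obtains d where "d > 0"
    "\<And>P G. P tagged_partial_division_of {a..b} \<Longrightarrow> G \<in> lmeasurable \<Longrightarrow> (\<And>x K. (x, K) \<in> P \<Longrightarrow> K \<subseteq> G) \<Longrightarrow>
       measure lebesgue G < d \<Longrightarrow> (\<Sum>(x, K)\<in>P. f (Sup K) - f (Inf K)) < e"
proof -
  obtain d where d: "d > 0" "\<And>I. finite I \<Longrightarrow> (\<forall>(u, v)\<in>I. a \<le> u \<and> u \<le> v \<and> v \<le> b) \<Longrightarrow>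
        disjoint_family_on (\<lambda>(u, v). {u<..<v}) I \<Longrightarrow> (\<Sum>(u, v)\<in>I. v - u) < d \<Longrightarrow>
        (\<Sum>(u, v)\<in>I. norm (f v - f u)) < e"
    by (rule abs_continuous_onE[OF ac e]) (rule that)
  show thesis
  proof (rule that[OF d(1)])
    fix P G
    assume P: "P tagged_partial_division_of {a..b}" and G: "G \<in> lmeasurable"
      and PG: "\<And>x K. (x, K) \<in> P \<Longrightarrow> K \<subseteq> G" and Gd: "measure lebesgue G < d"
    note PD = tagged_partial_division_ofD[OF P]
    define q where "q = (\<lambda>z::real \<times> real set. (Inf (snd z), Sup (snd z)))"
    have K: "\<exists>u v. K = {u..v} \<and> u \<le> v \<and> a \<le> u \<and> v \<le> b \<and> Inf K = u \<and> Sup K = v" if xK: "(x, K) \<in> P" for x K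
    proof -
      obtain u v where "K = {u..v}" using PD(4)[OF xK] by (auto simp: box_real)
      moreover have "x \<in> K" "K \<subseteq> {a..b}" using PD(2,3)[OF xK] by auto
      ultimately show ?thesis by (intro exI[of _ u] exI[of _ v]) auto
    qed
    \<comment> \<open>Pairs with different tags may share an interval, but only a degenerate one, whose
        contribution to each of the sums is 0.\<close>
    have dup: "Inf (snd y) = Sup (snd y)" if yzP: "y \<in> P" "z \<in> P" "y \<noteq> z" "q y = q z" for y z
    proof -
      obtain x1 K1 x2 K2 where yz: "y = (x1, K1)" "z = (x2, K2)" by fastforce
      have "interior K1 \<inter> interior K2 = {}" using PD(5) yzP yz by blast
      moreover obtain u v where "K1 = {u..v}" "u \<le> v" "Inf K1 = u" "Sup K1 = v" 
        using K yzP yz by blast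
      moreover obtain u' v' where "K2 = {u'..v'}" "u' \<le> v'" "Inf K2 = u'" "Sup K2 = v'" 
        using K yzP yz by blast
      ultimately show ?thesis using yzP(4) yz by (auto simp: q_def interior_atLeastAtMost_real)
    qed
    have reindex: "(\<Sum>(u, v)\<in>q ` P. \<phi> u v) = (\<Sum>(x, K)\<in>P. \<phi> (Inf K) (Sup K))"
      if "\<And>u. \<phi> u u = 0" for \<phi> :: "real \<Rightarrow> real \<Rightarrow> real"
    proof -
      have "(\<Sum>z\<in>q ` P. case_prod \<phi> z) = (\<Sum>z\<in>P. (case_prod \<phi> \<circ> q) z)"
      proof (rule trans[OF sum.reindex_nontrivial])
        show "finite P" by (rule PD)
        fix y z assume "y \<in> P" "z \<in> P" "y \<noteq> z" "q y = q z"
        from dup[OF this] show "case_prod \<phi> (q y) = 0" using that by (simp add: q_def)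
      qed simp
      then show ?thesis by (simp add: q_def split_beta)
    qed
    have div: "snd ` P division_of \<Union>(snd ` P)"
      by (rule partial_division_of_tagged_division[OF P])
    have "(\<Sum>(x, K)\<in>P. Sup K - Inf K) = (\<Sum>(x, K)\<in>P. measure lebesgue K)"
    proof (rule sum.cong[OF refl], clarify)
      fix x K assume "(x, K) \<in> P"
      then obtain u v where "K = {u..v}" "u \<le> v" using K by blast
      then show "Sup K - Inf K = measure lebesgue K" by simp
    qed
    also have "\<dots> = (\<Sum>K\<in>snd ` P. measure lebesgue K)"
    proof -
      have "(\<Sum>K\<in>snd ` P. measure lebesgue K) = (\<Sum>z\<in>P. (measure lebesgue \<circ> snd) z)"
      proof (rule trans[OF sum.reindex_nontrivial])
        show "finite P" by (rule PD)
        fix y z assume yz: "y \<in> P" "z \<in> P" "y \<noteq> z" "snd y = snd z"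
        then have "Inf (snd y) = Sup (snd y)" using dup[OF yz(1-3)] by (simp add: q_def)
        moreover obtain u v where "snd y = {u..v}" "u \<le> v" using K[of "fst y" "snd y"] yz(1) by auto
        ultimately show "measure lebesgue (snd y) = 0" by simp
      qed simp
      then show ?thesis by (simp add: split_beta)
    qed
    also have "\<dots> = measure lebesgue (\<Union>(snd ` P))"
      by (rule content_division[OF div])
    also have "\<dots> \<le> measure lebesgue G"
    proof (rule measure_mono_fmeasurable[OF _ _ G])
      show "\<Union>(snd ` P) \<subseteq> G" using PG by fastforce
      show "\<Union>(snd ` P) \<in> sets lebesgue"
        using lmeasurable_division[OF div] by auto
    qed
    finally have len: "(\<Sum>(x, K)\<in>P. Sup K - Inf K) < d" using Gd by simp
    have "(\<Sum>(x, K)\<in>P. f (Sup K) - f (Inf K)) \<le> (\<Sum>(x, K)\<in>P. norm (f (Sup K) - f (Inf K)))"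
      by (intro sum_mono) auto
    also have "\<dots> = (\<Sum>(u, v)\<in>q ` P. norm (f v - f u))"
      by (subst reindex) auto
    also have "\<dots> < e"
    proof (rule d(2))
      show "finite (q ` P)" using PD by simp
      show "\<forall>(u, v)\<in>q ` P. a \<le> u \<and> u \<le> v \<and> v \<le> b"
        using K by (fastforce simp: q_def)
      show "(\<Sum>(u, v)\<in>q ` P. v - u) < d"
        using len by (subst reindex) auto
      show "disjoint_family_on (\<lambda>(u, v). {u<..<v}) (q ` P)"
        unfolding disjoint_family_on_def
      proof (intro ballI impI)
        fix m n assume mn: "m \<in> q ` P" "n \<in> q ` P" "m \<noteq> n"
        from mn(1) obtain x1 K1 where P1: "(x1, K1) \<in> P" and m: "m = (Inf K1, Sup K1)"
          by (auto simp: q_def)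
        from mn(2) obtain x2 K2 where P2: "(x2, K2) \<in> P" and n: "n = (Inf K2, Sup K2)"
          by (auto simp: q_def)
        have "interior K1 \<inter> interior K2 = {}" using PD(5)[OF P1 P2] mn(3) m n by auto
        moreover have "interior K1 = {Inf K1<..<Sup K1}" "interior K2 = {Inf K2<..<Sup K2}"
          using K[OF P1] K[OF P2] interior_atLeastAtMost_real by metis+
        ultimately show "(case m of (u, v) \<Rightarrow> {u<..<v}) \<inter> (case n of (u, v) \<Rightarrow> {u<..<v}) = {}"
          using m n by simp
      qed
    qed
    finally show "(\<Sum>(x, K)\<in>P. f (Sup K) - f (Inf K)) < e" .
  qed
qed

text \<open>
  One half of the fundamental theorem of calculus for absolutely continuous functions, in
  the form of an inequality. Everything is read off one sufficiently fine tagged division of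
  \<open>{a..b}\<close>. At tags outside \<open>N\<close> the gauge makes the increment at most \<open>h x + e\<close> times the length, and these
  terms add up to nearly the integral of \<open>h\<close>. At tags in \<open>N\<close> the gauge keeps the intervals inside
  an open set of measure less than \<open>d\<close> around \<open>N\<close>, and absolute continuity makes their
  contribution small.
\<close>

theorem abs_continuous_on_increment_le_integral:
  fixes f h :: "real \<Rightarrow> real"
  assumes ab: "a \<le> b" and ac: "abs_continuous_on f a b" and N: "negligible N"
    and der: "\<And>t. t \<in> {a..b} - N \<Longrightarrow>
                \<exists>D\<le>h t. (f has_real_derivative D) (at t within {a..b})"
    and h: "h integrable_on {a..b}"
  shows "f b - f a \<le> integral {a..b} h"
proof (rule field_le_epsilon)
  fix e0 :: real assume "e0 > 0"
  \<comment> \<open>The error \<open>e\<close> is spent three times: once per unit length at the tags outside \<open>N\<close>, once at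
      the tags in \<open>N\<close>, once between the Riemann sum and the integral.\<close>
  define e where "e = e0 / (b - a + 2)"
  have e: "e > 0" "e * (b - a) + e + e = e0"
  proof -
    have "b - a + 2 > 0" using ab by simp
    then show "e > 0" using \<open>e0 > 0\<close> by (simp add: e_def)
    have "e * (b - a) + e + e = e * (b - a + 2)" by (simp add: algebra_simps)
    then show "e * (b - a) + e + e = e0" using \<open>b - a + 2 > 0\<close> by (simp add: e_def)
  qed
  obtain d where d: "d > 0"
    "\<And>P G. P tagged_partial_division_of {a..b} \<Longrightarrow> G \<in> lmeasurable \<Longrightarrow> (\<And>x K. (x, K) \<in> P \<Longrightarrow> K \<subseteq> G) \<Longrightarrow>
       measure lebesgue G < d \<Longrightarrow> (\<Sum>(x, K)\<in>P. f (Sup K) - f (Inf K)) < e"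
    using abs_continuous_on_tagged_sum[OF ac e(1)] by blast
  obtain G where G: "open G" "N \<subseteq> G" "G \<in> lmeasurable" "measure lebesgue G < d"
  proof -
    have "N \<in> lmeasurable" "measure lebesgue N = 0"
      using N negligible_iff_measure by auto
    then obtain G where "open G" "N \<subseteq> G" "G - N \<in> lmeasurable" "emeasure lebesgue (G - N) < ennreal d"
      using sets_lebesgue_outer_open[of N d] d(1) by (metis fmeasurableD)
    then have "(G - N) \<union> N \<in> lmeasurable"
      using \<open>N \<in> lmeasurable\<close> by (intro fmeasurable.Un)
    moreover have GN: "(G - N) \<union> N = G" using \<open>N \<subseteq> G\<close> by auto
    moreover have "measure lebesgue ((G - N) \<union> N) \<le> measure lebesgue (G - N) + measure lebesgue N"
      using \<open>N \<in> lmeasurable\<close> \<open>G - N \<in> lmeasurable\<close> by (intro measure_Un_le fmeasurableD)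
    moreover have "measure lebesgue (G - N) < d"
      using \<open>emeasure lebesgue (G - N) < ennreal d\<close> \<open>G - N \<in> lmeasurable\<close>
      by (simp add: emeasure_eq_measure2 ennreal_less_iff)
    ultimately show thesis
      using that[of G] \<open>open G\<close> \<open>N \<subseteq> G\<close> \<open>measure lebesgue N = 0\<close> by simp
  qed
  \<comment> \<open>Setting \<open>h\<close> to 0 on \<open>N\<close> preserves the integral and removes the tags in \<open>N\<close> from the
      Riemann sum.\<close>
  define h0 where "h0 t = (if t \<in> N then 0 else h t)" for t
  have "(h0 has_integral integral {a..b} h) {a..b}"
    by (rule has_integral_spike[OF N _ integrable_integral[OF h]]) (auto simp: h0_def)
  then obtain \<gamma> where \<gamma>: "gauge \<gamma>" "\<And>P. P tagged_division_of {a..b} \<Longrightarrow> \<gamma> fine P \<Longrightarrow>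
      norm ((\<Sum>(x, K)\<in>P. measure lborel K *\<^sub>R h0 x) - integral {a..b} h) < e"
    unfolding has_integral_real using e(1) by metis
  have "\<exists>\<delta>>0. \<forall>s\<in>{a..b}. dist s t < \<delta> \<longrightarrow> \<bar>f s - f t - D * (s - t)\<bar> \<le> e * \<bar>s - t\<bar>"
    if "(f has_real_derivative D) (at t within {a..b})" for t D
    using that e(1) unfolding has_field_derivative_def has_derivative_within_alt
    by (metis dist_norm real_norm_def)
  then have "\<forall>t\<in>{a..b} - N. \<exists>\<delta> D. \<delta> > 0 \<and> D \<le> h t \<and>
      (\<forall>s\<in>{a..b}. dist s t < \<delta> \<longrightarrow> \<bar>f s - f t - D * (s - t)\<bar> \<le> e * \<bar>s - t\<bar>)"
    using der by meson
  then obtain \<delta> D where \<delta>: "\<And>t. t \<in> {a..b} - N \<Longrightarrow> \<delta> t > 0"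
    and D: "\<And>t. t \<in> {a..b} - N \<Longrightarrow> D t \<le> h t"
    and \<delta>D: "\<And>t s. t \<in> {a..b} - N \<Longrightarrow> s \<in> {a..b} \<Longrightarrow> dist s t < \<delta> t \<Longrightarrow>
           \<bar>f s - f t - D t * (s - t)\<bar> \<le> e * \<bar>s - t\<bar>"
    by metis
  define \<gamma>' where "\<gamma>' t = (if t \<in> N then G else if t \<in> {a..b} then ball t (\<delta> t) else ball t 1)" for t
  have "gauge \<gamma>'"
    using G \<delta> by (auto simp: gauge_def \<gamma>'_def)
  then have "gauge (\<lambda>t. \<gamma> t \<inter> \<gamma>' t)" using \<gamma>(1) by (rule gauge_Int[rotated])
  then obtain P where P: "P tagged_division_of {a..b}" and fine: "\<gamma> fine P" "\<gamma>' fine P"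
    using fine_division_exists_real[of _ a b] by (metis fine_Int)
  note PD = tagged_division_ofD[OF P]
  define Q where "Q = {z \<in> P. fst z \<in> N}"
  have QP: "Q \<subseteq> P" by (auto simp: Q_def)
  have bad: "(\<Sum>(x, K)\<in>Q. f (Sup K) - f (Inf K)) < e"
  proof (rule d(2)[OF _ G(3) _ G(4)])
    show "Q tagged_partial_division_of {a..b}"
      using P QP tagged_partial_division_subset unfolding tagged_division_of_def by blast
    show "K \<subseteq> G" if "(x, K) \<in> Q" for x K
      using fineD[OF fine(2), of x K] that by (auto simp: Q_def \<gamma>'_def)
  qed
  have good: "(\<Sum>(x, K)\<in>P - Q. f (Sup K) - f (Inf K))
      \<le> (\<Sum>(x, K)\<in>P - Q. measure lborel K *\<^sub>R h0 x + e * measure lborel K)"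
  proof (rule sum_mono, clarify)
    fix x K assume xK: "(x, K) \<in> P" "(x, K) \<notin> Q"
    then have xN: "x \<notin> N" by (auto simp: Q_def)
    obtain u v where K: "K = {u..v}" using PD(4)[OF xK(1)] by (auto simp: box_real)
    have x: "x \<in> {u..v}" "{u..v} \<subseteq> {a..b}" using PD(2,3)[OF xK(1)] K by auto
    then have uv: "u \<le> x" "x \<le> v" "a \<le> u" "v \<le> b" by auto
    then have xab: "x \<in> {a..b} - N" using xN by auto
    have "{u..v} \<subseteq> ball x (\<delta> x)"
      using fineD[OF fine(2) xK(1)] K xab by (auto simp: \<gamma>'_def)
    moreover have "u \<in> {u..v}" "v \<in> {u..v}" using uv by auto
    ultimately have "u \<in> ball x (\<delta> x)" "v \<in> ball x (\<delta> x)" by blast+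
    then have "\<bar>f u - f x - D x * (u - x)\<bar> \<le> e * \<bar>u - x\<bar>" "\<bar>f v - f x - D x * (v - x)\<bar> \<le> e * \<bar>v - x\<bar>"
      using uv \<delta>D[OF xab, of u] \<delta>D[OF xab, of v] by (auto simp: dist_commute)
    then have "f v - f u \<le> D x * (v - x) - D x * (u - x) + e * (v - x) + e * (x - u)"
      using uv by (smt (verit))
    also have "\<dots> = D x * (v - u) + e * (v - u)" by (simp add: algebra_simps)
    also have "\<dots> \<le> h x * (v - u) + e * (v - u)"
      using D[OF xab] uv by (intro add_right_mono mult_right_mono) auto
    finally show "f (Sup K) - f (Inf K) \<le> measure lborel K *\<^sub>R h0 x + e * measure lborel K"
      using uv xN K by (simp add: h0_def mult.commute)
  qed
  have "f b - f a = (\<Sum>(x, K)\<in>P. f (Sup K) - f (Inf K))"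
    by (rule additive_tagged_division_1[OF ab P, symmetric])
  also have "\<dots> = (\<Sum>(x, K)\<in>P - Q. f (Sup K) - f (Inf K)) + (\<Sum>(x, K)\<in>Q. f (Sup K) - f (Inf K))"
    by (rule sum.subset_diff[OF QP PD(1)])
  also have "\<dots> \<le> (\<Sum>(x, K)\<in>P - Q. measure lborel K *\<^sub>R h0 x + e * measure lborel K) + e"
    using good bad by linarith
  also have "(\<Sum>(x, K)\<in>P - Q. measure lborel K *\<^sub>R h0 x + e * measure lborel K)
      \<le> (\<Sum>(x, K)\<in>P. measure lborel K *\<^sub>R h0 x + e * measure lborel K)"
    using PD(1) QP e(1) by (intro sum_mono2) (auto simp: Q_def h0_def)
  also have "\<dots> = (\<Sum>(x, K)\<in>P. measure lborel K *\<^sub>R h0 x) + e * (\<Sum>(x, K)\<in>P. measure lborel K)"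
    by (simp add: sum.distrib sum_distrib_left split_beta)
  also have "(\<Sum>(x, K)\<in>P. measure lborel K) = b - a"
    using additive_content_tagged_division[of P a b] P ab by (simp add: box_real)
  also have "(\<Sum>(x, K)\<in>P. measure lborel K *\<^sub>R h0 x) \<le> integral {a..b} h + e"
    using \<gamma>(2)[OF P fine(1)] by (simp add: abs_less_iff)
  finally show "f b - f a \<le> integral {a..b} h + e0" using e(2) by linarith
qed

section \<open>The energy estimate\<close>

text \<open>Restricting to the line through \<open>y\<close> and \<open>z\<close> reduces this to convex functions of one variable.\<close>

lemma convex_on_gradient_inequality:
  fixes \<Phi> :: "'a::real_inner \<Rightarrow> real"
  assumes conv: "convex_on UNIV \<Phi>" and G: "GDERIV \<Phi> y :> G"
  shows "\<Phi> z \<ge> \<Phi> y + inner (z - y) G"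
proof -
  define f where "f s = \<Phi> (y + s *\<^sub>R (z - y))" for s :: real
  have "convex_on UNIV f"
  proof (rule convex_onI)
    fix t r s :: real assume "0 < t" "t < 1"
    have "y + ((1 - t) *\<^sub>R r + t *\<^sub>R s) *\<^sub>R (z - y)
        = (1 - t) *\<^sub>R (y + r *\<^sub>R (z - y)) + t *\<^sub>R (y + s *\<^sub>R (z - y))"
      by (simp add: algebra_simps)
    then show "f ((1 - t) *\<^sub>R r + t *\<^sub>R s) \<le> (1 - t) * f r + t * f s"
      unfolding f_def using convex_onD[OF conv] \<open>0 < t\<close> \<open>t < 1\<close> by simp
  qed simp
  moreover have "(f has_real_derivative inner (z - y) G) (at 0 within UNIV)"
  proof -
    have "(\<Phi> has_derivative (\<lambda>h. inner h G)) (at (y + 0 *\<^sub>R (z - y)))"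
      using G by (simp add: gderiv_def)
    then have "(f has_derivative (\<lambda>s. inner (s *\<^sub>R (z - y)) G)) (at 0)"
      unfolding f_def by (rule has_derivative_compose[rotated]) (auto intro!: derivative_eq_intros)
    then show ?thesis
      by (simp add: has_field_derivative_def mult_commute_abs)
  qed
  ultimately have "f 1 - f 0 \<ge> inner (z - y) G * (1 - 0)"
    by (intro convex_on_imp_above_tangent[of UNIV]) auto
  then show ?thesis by (simp add: f_def)
qed

text \<open>
  The pointwise computation behind the Lyapunov argument. Here \<open>X\<close> stands for \<open>x - z\<close>, \<open>V\<close> for
  the velocity, \<open>G\<close> for the gradient, \<open>W\<close> for \<open>\<Phi>(x) - \<Phi>(z)\<close>, \<open>y\<close> for \<open>t\<^sup>p\<close> and \<open>r\<close> for \<open>1/t\<close>. The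
  left-hand side is then the derivative of the energy, with the equation of motion
  substituted for the acceleration. After removal of the term in \<open>g\<close> it becomes a sum of a
  convexity term, a term in \<open>\<parallel>X\<parallel>\<^sup>2\<close> and a term in \<open>\<parallel>V\<parallel>\<^sup>2\<close>, each nonpositive; the inner product of
  \<open>X\<close> and \<open>V\<close> drops out by the choice of \<open>c\<close>.
\<close>

lemma energy_dissipation:
  fixes X V G :: "'a::real_inner"
  assumes p: "p > 0" "p \<le> 1" "3 * p \<le> \<alpha>" and c: "c = 2 * p * (\<alpha> + 1 - 4 * p)"
    and cross: "0 \<le> c"
    and r: "r > 0" and conv: "W \<le> inner X G"
  shows "4 * p * y^2 * r * W + 2 * y^2 * inner V G
       + c * (2 * p - 2) * y^2 * r^3 * (norm X)^2 + 2 * c * y^2 * r^2 * inner X V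
       + 2 * inner ((2 * p * y * r) *\<^sub>R X + y *\<^sub>R V)
           ((2 * p * (p - 1) * y * r^2) *\<^sub>R X + (3 * p * y * r) *\<^sub>R V + y *\<^sub>R (g - (\<alpha> * r) *\<^sub>R V - G))
     \<le> 2 * inner ((2 * p * y * r) *\<^sub>R X + y *\<^sub>R V) (y *\<^sub>R g)"
    (is "?L \<le> ?R")
proof -
  have "?L - ?R = y^2 * (4 * p * r * (W - inner X G) + r^3 * (norm X)^2 * ((p - 1) * (2 * c + 8 * p^2))
       + (3 * p - \<alpha>) * (2 * r * (norm V)^2))"
    unfolding c power2_norm_eq_inner
    by (simp add: inner_add_left inner_add_right inner_diff_right inner_commute[of V X]
        power2_eq_square power3_eq_cube algebra_simps)
  moreover have "4 * p * r * (W - inner X G) \<le> 0"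
    using p r conv by (intro mult_nonneg_nonpos) auto
  moreover have "r^3 * (norm X)^2 * ((p - 1) * (2 * c + 8 * p^2)) \<le> 0"
    using p r cross by (intro mult_nonneg_nonpos mult_nonpos_nonneg) auto
  moreover have "(3 * p - \<alpha>) * (2 * r * (norm V)^2) \<le> 0"
    using p r by (intro mult_nonpos_nonneg) auto
  ultimately have "?L - ?R \<le> 0"
    by (metis add_nonpos_nonpos mult_nonneg_nonpos zero_le_power2)
  then show ?thesis by simp
qed

text \<open>
  The factor \<open>norm u\<close> that Cauchy--Schwarz produces is absorbed by the denominator
  \<open>2 * sqrt (Q t)\<close> of the chain rule.
\<close>

lemma sqrt_derivative_le:
  fixes Q :: "real \<Rightarrow> real" and u w :: "'a::real_inner"
  assumes Q: "(Q has_real_derivative D) (at t within S)"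
    and D: "D \<le> 2 * inner u w" and ge: "1 \<le> Q t" "(norm u)^2 \<le> Q t"
  shows "\<exists>D'\<le>norm w. ((\<lambda>s. sqrt (Q s)) has_real_derivative D') (at t within S)"
proof (intro exI conjI)
  show "((\<lambda>s. sqrt (Q s)) has_real_derivative D / (2 * sqrt (Q t))) (at t within S)"
    using ge by (auto intro!: derivative_eq_intros Q simp: field_simps)
  have "norm u \<le> sqrt (Q t)" using ge by (simp add: real_le_rsqrt)
  then have "norm u * norm w \<le> sqrt (Q t) * norm w" by (intro mult_right_mono) auto
  moreover have "D \<le> 2 * (norm u * norm w)" using D norm_cauchy_schwarz[of u w] by linarith
  ultimately have "D \<le> norm w * (2 * sqrt (Q t))" by (simp add: mult_ac)
  then show "D / (2 * sqrt (Q t)) \<le> norm w" using ge by (simp add: divide_le_eq)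
qed

lemma integral_Icc_le_of_set_integrable:
  fixes f :: "real \<Rightarrow> real"
  assumes f: "set_integrable lebesgue S f" and K: "{a..b} \<subseteq> S" and nonneg: "\<And>t. t \<in> S \<Longrightarrow> 0 \<le> f t"
  shows "f integrable_on {a..b}" "integral {a..b} f \<le> integral S f"
proof -
  have S: "f integrable_on S"
    using f by (rule set_lebesgue_integral_eq_integral(1))
  have "set_integrable lebesgue {a..b} f"
    by (rule set_integrable_subset[OF f _ K]) auto
  then show *: "f integrable_on {a..b}"
    by (rule set_lebesgue_integral_eq_integral(1))
  show "integral {a..b} f \<le> integral S f"
    by (rule integral_subset_le[OF K * S]) (use nonneg in blast)
qed

lemma bounded_Lipschitz_continuous_on:
  fixes F :: "'a::metric_space \<Rightarrow> 'b::metric_space"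
  assumes "\<And>S. bounded S \<Longrightarrow> \<exists>L. L-lipschitz_on S F"
  shows "continuous_on UNIV F"
proof -
  have "isCont F z" for z
  proof -
    obtain L where "L-lipschitz_on (ball z 1) F" using assms bounded_ball by blast
    then have "continuous_on (ball z 1) F" by (rule lipschitz_on_continuous_on)
    then show ?thesis by (simp add: continuous_on_eq_continuous_at)
  qed
  then show ?thesis by (simp add: continuous_on_eq_continuous_at)
qed

text \<open>
  Twice the usual Lyapunov function, so that no factors 1/2 appear; \<open>v\<close> is the velocity of \<open>x\<close>,
  and the argument of the last norm plays the role of a momentum relative to \<open>z\<close>.
\<close>

definition energy :: "('a::real_inner \<Rightarrow> real) \<Rightarrow> real \<Rightarrow> real \<Rightarrow> 'a \<Rightarrow> (real \<Rightarrow> 'a) \<Rightarrow> (real \<Rightarrow> 'a) \<Rightarrow> real \<Rightarrow> real" where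
  "energy \<Phi> \<alpha> p z x v t =
     2 * t powr (2 * p) * (\<Phi> (x t) - \<Phi> z)
     + 2 * p * (\<alpha> + 1 - 4 * p) * t powr (2 * p - 2) * (norm (x t - z))^2
     + (norm ((2 * p * t powr (p - 1)) *\<^sub>R (x t - z) + t powr p *\<^sub>R v t))^2"

context
  fixes \<Phi> :: "'a::real_inner \<Rightarrow> real" and grad :: "'a \<Rightarrow> 'a" and \<alpha> p a :: real
    and z :: 'a and x v :: "real \<Rightarrow> 'a"
  assumes grad: "\<And>y. GDERIV \<Phi> y :> grad y"
    and cont_grad: "continuous_on UNIV grad"
    and a: "a > 0"
    and x: "\<And>t. t \<ge> a \<Longrightarrow> (x has_vector_derivative v t) (at t within {a..})"
    and cont_v: "continuous_on {a..} v"
begin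

text \<open>
  The part of the energy that involves the velocity only through \<open>x\<close> is continuously
  differentiable; the weight \<open>c\<close> is arbitrary here.
\<close>

lemma has_real_derivative_potential_part:
  assumes t: "t \<ge> a"
  shows "((\<lambda>t. 2 * t powr (2 * p) * (\<Phi> (x t) - \<Phi> z) + c * t powr (2 * p - 2) * (norm (x t - z))^2)
    has_real_derivative
       4 * p * t powr (2 * p - 1) * (\<Phi> (x t) - \<Phi> z) + 2 * t powr (2 * p) * inner (v t) (grad (x t))
     + c * (2 * p - 2) * t powr (2 * p - 3) * (norm (x t - z))^2
     + 2 * c * t powr (2 * p - 2) * inner (x t - z) (v t)) (at t within {a..})"
proof -
  have t0: "t > 0" using t a by simp
  have xd: "(x has_derivative (\<lambda>h. h *\<^sub>R v t)) (at t within {a..})"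
    using x[OF t] by (simp add: has_vector_derivative_def)
  have "(\<Phi> has_derivative (\<lambda>h. inner h (grad (x t)))) (at (x t))"
    using grad by (simp add: gderiv_def)
  from has_derivative_compose[OF xd this]
  have \<Phi>: "((\<lambda>t. \<Phi> (x t)) has_real_derivative inner (v t) (grad (x t))) (at t within {a..})"
    by (simp add: has_field_derivative_def mult_commute_abs)
  have "((\<lambda>t. inner (x t - z) (x t - z)) has_derivative
      (\<lambda>h. inner (x t - z) (h *\<^sub>R v t) + inner (h *\<^sub>R v t) (x t - z))) (at t within {a..})"
    by (rule derivative_eq_intros xd refl | simp)+
  moreover have "(\<lambda>h. inner (x t - z) (h *\<^sub>R v t) + inner (h *\<^sub>R v t) (x t - z))
      = (*) (2 * inner (x t - z) (v t))"
    by (simp add: fun_eq_iff inner_commute[of "v t"])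
  ultimately have n: "((\<lambda>t. (norm (x t - z))^2) has_real_derivative 2 * inner (x t - z) (v t)) (at t within {a..})"
    by (simp add: has_field_derivative_def power2_norm_eq_inner)
  have pw: "((\<lambda>t. t powr q) has_real_derivative q * t powr (q - 1)) (at t within {a..})" for q
    using t0 has_real_derivative_powr has_field_derivative_at_within by blast
  have "((\<lambda>t. 2 * t powr (2 * p) * (\<Phi> (x t) - \<Phi> z) + c * t powr (2 * p - 2) * (norm (x t - z))^2)
    has_real_derivative
       (2 * (2 * p * t powr (2 * p - 1))) * (\<Phi> (x t) - \<Phi> z)
       + inner (v t) (grad (x t)) * (2 * t powr (2 * p))
     + ((c * ((2 * p - 2) * t powr (2 * p - 2 - 1))) * (norm (x t - z))^2
       + (2 * inner (x t - z) (v t)) * (c * t powr (2 * p - 2)))) (at t within {a..})"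
    by (intro DERIV_add DERIV_mult DERIV_cmult pw n \<Phi> DERIV_diff[where E=0, simplified] DERIV_const)
  then show ?thesis
    by (simp add: algebra_simps)
qed

lemma has_vector_derivative_momentum:
  assumes t: "t \<ge> a" and w: "(v has_vector_derivative w) (at t within {a..})"
  shows "((\<lambda>t. (2 * p * t powr (p - 1)) *\<^sub>R (x t - z) + t powr p *\<^sub>R v t) has_vector_derivative
     ((2 * p * (p - 1) * t powr (p - 2)) *\<^sub>R (x t - z) + (3 * p * t powr (p - 1)) *\<^sub>R v t + t powr p *\<^sub>R w))
     (at t within {a..})"
proof -
  have t0: "t > 0" using t a by simp
  have pw: "((\<lambda>t. t powr q) has_real_derivative q * t powr (q - 1)) (at t within {a..})" for q
    using t0 has_real_derivative_powr has_field_derivative_at_within by blast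
  have xz: "((\<lambda>t. x t - z) has_vector_derivative v t) (at t within {a..})"
    using has_vector_derivative_diff[OF x[OF t] has_vector_derivative_const[of z]] by simp
  have "((\<lambda>t. (2 * p * t powr (p - 1)) *\<^sub>R (x t - z) + t powr p *\<^sub>R v t) has_vector_derivative
     (((2 * p * t powr (p - 1)) *\<^sub>R v t + (2 * p * ((p - 1) * t powr (p - 1 - 1))) *\<^sub>R (x t - z))
      + (t powr p *\<^sub>R w + (p * t powr (p - 1)) *\<^sub>R v t))) (at t within {a..})"
    by (intro has_vector_derivative_add has_vector_derivative_scaleR DERIV_cmult pw xz w)
  moreover have "p - 1 - 1 = p - 2" by simp
  moreover have "(3 * p * t powr (p - 1)) *\<^sub>R v t
      = (2 * p * t powr (p - 1)) *\<^sub>R v t + (p * t powr (p - 1)) *\<^sub>R v t"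
    by (simp flip: scaleR_left_distrib)
  ultimately show ?thesis by (simp only: add_ac mult.assoc)
qed

lemma abs_continuous_on_energy:
  assumes ac: "abs_continuous_on v a b"
  shows "abs_continuous_on (energy \<Phi> \<alpha> p z x v) a b"
proof -
  have sub: "{a..b} \<subseteq> {a..}" by auto
  have cv: "continuous_on {a..b} v" using cont_v sub by (rule continuous_on_subset)
  have xd: "(x has_vector_derivative v t) (at t within {a..b})" if "t \<in> {a..b}" for t
    using has_vector_derivative_within_subset[OF x sub] that by auto
  then have cx: "continuous_on {a..b} x"
    by (meson has_vector_derivative_continuous continuous_on_eq_continuous_within)
  have cG: "continuous_on {a..b} (\<lambda>t. grad (x t))"
    using continuous_on_compose2[OF cont_grad cx] by simp
  have "continuous_on UNIV \<Phi>"
    using grad unfolding gderiv_def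
    by (meson has_derivative_continuous continuous_on_eq_continuous_at open_UNIV)
  then have c\<Phi>: "continuous_on {a..b} (\<lambda>t. \<Phi> (x t))"
    using continuous_on_compose2[OF _ cx] by auto
  have pos: "\<And>t. t \<in> {a..b} \<Longrightarrow> t \<noteq> 0" using a by auto
  have "abs_continuous_on (\<lambda>t. 2 * t powr (2 * p) * (\<Phi> (x t) - \<Phi> z)
     + 2 * p * (\<alpha> + 1 - 4 * p) * t powr (2 * p - 2) * (norm (x t - z))^2) a b"
  proof (rule abs_continuous_on_C1)
    fix t assume "t \<in> {a..b}"
    then show "((\<lambda>t. 2 * t powr (2 * p) * (\<Phi> (x t) - \<Phi> z)
       + 2 * p * (\<alpha> + 1 - 4 * p) * t powr (2 * p - 2) * (norm (x t - z))^2) has_vector_derivative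
       4 * p * t powr (2 * p - 1) * (\<Phi> (x t) - \<Phi> z) + 2 * t powr (2 * p) * inner (v t) (grad (x t))
     + 2 * p * (\<alpha> + 1 - 4 * p) * (2 * p - 2) * t powr (2 * p - 3) * (norm (x t - z))^2
     + 2 * (2 * p * (\<alpha> + 1 - 4 * p)) * t powr (2 * p - 2) * inner (x t - z) (v t)) (at t within {a..b})"
      unfolding has_real_derivative_iff_has_vector_derivative[symmetric]
      by (intro DERIV_subset[OF has_real_derivative_potential_part sub]) auto
  qed (use pos in \<open>intro continuous_intros cx cv cG c\<Phi>; auto\<close>)
  moreover have "abs_continuous_on (\<lambda>t. (norm ((2 * p * t powr (p - 1)) *\<^sub>R (x t - z) + t powr p *\<^sub>R v t))^2) a b"
  proof -
    have C1: "abs_continuous_on (\<lambda>t. k * t powr q) a b" for k q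
    proof (rule abs_continuous_on_C1)
      fix t assume "t \<in> {a..b}"
      then have "t > 0" using a by auto
      then show "((\<lambda>t. k * t powr q) has_vector_derivative k * (q * t powr (q - 1))) (at t within {a..b})"
        unfolding has_real_derivative_iff_has_vector_derivative[symmetric]
        by (intro DERIV_cmult has_field_derivative_at_within[OF has_real_derivative_powr])
    qed (use pos in \<open>intro continuous_intros; auto\<close>)
    have xz: "abs_continuous_on (\<lambda>t. x t - z) a b"
    proof (rule abs_continuous_on_C1[OF _ cv])
      fix t assume "t \<in> {a..b}"
      from has_vector_derivative_diff[OF xd[OF this] has_vector_derivative_const[of z]]
      show "((\<lambda>t. x t - z) has_vector_derivative v t) (at t within {a..b})" by simp
    qed
    have cp: "continuous_on {a..b} (\<lambda>t. k * t powr q)" for k q :: real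
      using pos by (intro continuous_intros) auto
    have cxz: "continuous_on {a..b} (\<lambda>t. x t - z)" by (intro continuous_intros cx)
    have u: "abs_continuous_on (\<lambda>t. (2 * p * t powr (p - 1)) *\<^sub>R (x t - z) + (1 * t powr p) *\<^sub>R v t) a b"
      by (intro abs_continuous_on_add bounded_bilinear.abs_continuous_on_prod[OF bounded_bilinear_scaleR]
            C1 xz ac cp cxz cv)
    have cu: "continuous_on {a..b} (\<lambda>t. (2 * p * t powr (p - 1)) *\<^sub>R (x t - z) + (1 * t powr p) *\<^sub>R v t)"
      by (intro continuous_on_add continuous_on_scaleR cp cxz cv)
    show ?thesis
      using bounded_bilinear.abs_continuous_on_prod[OF bounded_bilinear_inner u u cu cu]
      by (simp add: power2_norm_eq_inner)
  qed
  ultimately show ?thesis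
    unfolding energy_def by (rule abs_continuous_on_add)
qed

text \<open>
  All powers of \<open>t\<close> are rewritten as powers of \<open>t\<^sup>p\<close> and \<open>1/t\<close>, which turns the claim into the
  polynomial inequality \<open>energy_dissipation\<close>.
\<close>

lemma energy_derivative_le:
  assumes conv: "convex_on UNIV \<Phi>" and p: "p > 0" "p \<le> 1" "3 * p \<le> \<alpha>" "4 * p \<le> \<alpha> + 1"
    and t: "t \<ge> a" and w: "(v has_vector_derivative w) (at t within {a..})"
    and eq: "w + (\<alpha> / t) *\<^sub>R v t + grad (x t) = g"
  shows "\<exists>D. (energy \<Phi> \<alpha> p z x v has_real_derivative D) (at t within {a..}) \<and>
     D \<le> 2 * inner ((2 * p * t powr (p - 1)) *\<^sub>R (x t - z) + t powr p *\<^sub>R v t) (t powr p *\<^sub>R g)"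
proof -
  define c where "c = 2 * p * (\<alpha> + 1 - 4 * p)"
  define u where "u t = (2 * p * t powr (p - 1)) *\<^sub>R (x t - z) + t powr p *\<^sub>R v t" for t
  define u' where "u' = (2 * p * (p - 1) * t powr (p - 2)) *\<^sub>R (x t - z)
      + (3 * p * t powr (p - 1)) *\<^sub>R v t + t powr p *\<^sub>R w"
  define D where "D = 4 * p * t powr (2 * p - 1) * (\<Phi> (x t) - \<Phi> z)
     + 2 * t powr (2 * p) * inner (v t) (grad (x t))
     + c * (2 * p - 2) * t powr (2 * p - 3) * (norm (x t - z))^2
     + 2 * c * t powr (2 * p - 2) * inner (x t - z) (v t)"
  have "(u has_derivative (\<lambda>h. h *\<^sub>R u')) (at t within {a..})"
    using has_vector_derivative_momentum[OF t w]
    unfolding u_def u'_def has_vector_derivative_def .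
  then have "((\<lambda>t. inner (u t) (u t)) has_derivative (\<lambda>h. inner (u t) (h *\<^sub>R u') + inner (h *\<^sub>R u') (u t)))
      (at t within {a..})"
    by (intro has_derivative_inner)
  moreover have "(\<lambda>h. inner (u t) (h *\<^sub>R u') + inner (h *\<^sub>R u') (u t)) = (*) (2 * inner (u t) u')"
    by (simp add: fun_eq_iff inner_commute[of u'])
  ultimately have "((\<lambda>t. (norm (u t))^2) has_real_derivative 2 * inner (u t) u') (at t within {a..})"
    by (simp add: has_field_derivative_def power2_norm_eq_inner)
  then have "(energy \<Phi> \<alpha> p z x v has_real_derivative D + 2 * inner (u t) u') (at t within {a..})"
    using DERIV_add[OF has_real_derivative_potential_part[OF t, of c]]
    unfolding energy_def[abs_def] u_def D_def c_def by blast
  moreover have "D + 2 * inner (u t) u' \<le> 2 * inner (u t) (t powr p *\<^sub>R g)"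
  proof -
    define r where "r = 1 / t"
    define y where "y = t powr p"
    have t0: "t > 0" using t a by simp
    have e: "t powr (q - real n) = t powr q * r ^ n" for q n
      using t0 by (simp add: r_def powr_diff powr_realpow power_one_over)
    have y2: "t powr (2 * p) = y^2"
      using t0 by (simp add: y_def power2_eq_square flip: powr_add)
    have pw: "t powr (p - 1) = y * r" "t powr (p - 2) = y * r^2" "t powr (2 * p - 1) = y^2 * r"
      "t powr (2 * p - 2) = y^2 * r^2" "t powr (2 * p - 3) = y^2 * r^3"
      using e[of _ 1] e[of _ 2] e[of _ 3] y2 by (simp_all add: y_def)
    have w: "w = g - (\<alpha> * r) *\<^sub>R v t - grad (x t)"
      using eq by (simp add: r_def algebra_simps)
    have "\<Phi> (x t) - \<Phi> z \<le> inner (x t - z) (grad (x t))"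
      using convex_on_gradient_inequality[OF conv grad, of "x t" z] by (simp add: inner_diff_left)
    from energy_dissipation[OF p(1-3) c_def _ _ this, of r y "v t" g] show ?thesis
      unfolding D_def u_def u'_def pw y2 w y_def[symmetric]
      using p t0 by (simp add: c_def r_def mult.assoc)
  qed
  ultimately show ?thesis unfolding u_def by blast
qed

end

lemma min_value_eq:
  assumes "z \<in> argmin \<Phi>"
  shows "min_value \<Phi> = \<Phi> z" and "\<Phi> z \<le> \<Phi> y"
proof -
  show *: "\<Phi> z \<le> \<Phi> y" for y using assms by (auto simp: argmin_def is_arg_min_def not_less)
  show "min_value \<Phi> = \<Phi> z"
    unfolding min_value_def by (rule Least_equality) (use * in auto)
qed

theorem theorem5p1:
  fixes \<Phi> :: "'a::{real_inner, banach} \<Rightarrow> real"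
    and grad\<Phi> :: "'a \<Rightarrow> 'a"
    and g x :: "real \<Rightarrow> 'a"
    and t0 \<alpha> p :: real
  assumes "convex_on UNIV \<Phi>"
    and "\<And>z. GDERIV \<Phi> z :> grad\<Phi> z"
    and "\<And>S. bounded S \<Longrightarrow> \<exists>L. L-lipschitz_on S grad\<Phi>"
    and "argmin \<Phi> \<noteq> {}"
    and "t0 > 0" and "\<alpha> > 0"
    and "locally_integrable_on g {t0..}"
    and "is_solution grad\<Phi> \<alpha> g t0 x"
    and "p = min 1 (\<alpha> / 3)"
    and "set_integrable lebesgue {t0..} (\<lambda>t. t powr p * norm (g t))"
  shows "(\<lambda>t. \<Phi> (x t) - min_value \<Phi>) \<in> O[at_top](\<lambda>t. 1 / t powr (2 * p))"
proof -
  have p: "p > 0" "p \<le> 1" "3 * p \<le> \<alpha>" "4 * p \<le> \<alpha> + 1"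
    using assms(6,9) by (auto simp: min_def)
  have cG: "continuous_on UNIV grad\<Phi>" using assms(3) by (rule bounded_Lipschitz_continuous_on)
  obtain z where "z \<in> argmin \<Phi>" using assms(4) by blast
  note z = min_value_eq[OF this]
  obtain v where x: "\<And>t. t \<ge> t0 \<Longrightarrow> (x has_vector_derivative v t) (at t within {t0..})"
    and cv: "continuous_on {t0..} v" and ac: "locally_abs_continuous_on v {t0..}"
    and ode: "AE t in lebesgue. t \<ge> t0 \<longrightarrow> (\<exists>w. (v has_vector_derivative w) (at t within {t0..}) \<and>
                  w + (\<alpha> / t) *\<^sub>R v t + grad\<Phi> (x t) = g t)"
    using assms(8) unfolding is_solution_def by blast
  from ode obtain N where N: "N \<in> null_sets lebesgue"
    and ode: "\<And>t. t \<notin> N \<Longrightarrow> t \<ge> t0 \<Longrightarrow> \<exists>w. (v has_vector_derivative w) (at t within {t0..}) \<and>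
                  w + (\<alpha> / t) *\<^sub>R v t + grad\<Phi> (x t) = g t"
    by (auto elim!: AE_E3)
  define E where "E = energy \<Phi> \<alpha> p z x v"
  define h where "h t = t powr p * norm (g t)" for t
  \<comment> \<open>The integral runs over the whole half-line, so \<open>C\<close> bounds \<open>sqrt (1 + E T)\<close> uniformly in \<open>T\<close>.\<close>
  define C where "C = sqrt (1 + E t0) + integral {t0..} h"
  have E_ge: "2 * t powr (2 * p) * (\<Phi> (x t) - \<Phi> z) \<le> E t"
    "(norm ((2 * p * t powr (p - 1)) *\<^sub>R (x t - z) + t powr p *\<^sub>R v t))^2 \<le> E t" "0 \<le> E t" for t
    using p z(2)[of "x t"] by (simp_all add: E_def energy_def)
  have "sqrt (1 + E T) \<le> C" if T: "T \<ge> t0" for T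
  proof -
    have h: "h integrable_on {t0..T}" "integral {t0..T} h \<le> integral {t0..} h"
      by (rule integral_Icc_le_of_set_integrable[OF assms(10)[folded h_def]]; simp add: h_def)+
    have sub: "{t0..T} \<subseteq> {t0..}" by auto
    have "abs_continuous_on v t0 T"
      using ac sub unfolding locally_abs_continuous_on_def by blast
    then have "abs_continuous_on E t0 T"
      unfolding E_def using assms(2,5) cG x cv by (intro abs_continuous_on_energy)
    moreover have "abs_continuous_on (\<lambda>t. 1 :: real) t0 T"
      by (rule abs_continuous_on_C1[where f' = "\<lambda>_. 0"]) auto
    ultimately have "abs_continuous_on (\<lambda>t. sqrt (1 + E t)) t0 T"
      using E_ge(3) by (intro abs_continuous_on_sqrt abs_continuous_on_add) auto
    moreover have "\<exists>D\<le>h t. ((\<lambda>t. sqrt (1 + E t)) has_real_derivative D) (at t within {t0..T})"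
      if t: "t \<in> {t0..T} - N" for t
    proof -
      have t1: "t \<ge> t0" "t > 0" using t assms(5) by auto
      obtain w where w: "(v has_vector_derivative w) (at t within {t0..})"
        "w + (\<alpha> / t) *\<^sub>R v t + grad\<Phi> (x t) = g t"
        using ode t by auto
      from energy_derivative_le[OF assms(2) cG assms(5) x cv assms(1) p t1(1) w]
      obtain D where D: "(E has_real_derivative D) (at t within {t0..})"
        "D \<le> 2 * inner ((2 * p * t powr (p - 1)) *\<^sub>R (x t - z) + t powr p *\<^sub>R v t) (t powr p *\<^sub>R g t)"
        unfolding E_def by metis
      have "((\<lambda>t. 1 + E t) has_real_derivative D) (at t within {t0..T})"
        using DERIV_add[OF DERIV_const[of 1] DERIV_subset[OF D(1) sub]] by simp
      from sqrt_derivative_le[OF this D(2)] E_ge(2,3)[of t] t1(2)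
      show ?thesis by (simp add: h_def order_trans[OF E_ge(2)])
    qed
    ultimately have "sqrt (1 + E T) - sqrt (1 + E t0) \<le> integral {t0..T} h"
      using N h(1) by (intro abs_continuous_on_increment_le_integral[OF T, of _ N])
        (auto simp: negligible_iff_null_sets)
    then show ?thesis using h(2) unfolding C_def by linarith
  qed
  then have bound: "E T \<le> C^2" if "T \<ge> t0" for T
    using that E_ge(3)[of T] real_sqrt_le_iff[of "1 + E T" "C^2"]
    by (smt (verit) real_sqrt_ge_zero sqrt_le_D)
  show ?thesis
  proof (rule bigoI[where c = "C^2"])
    show "\<forall>\<^sub>F t in at_top. norm (\<Phi> (x t) - min_value \<Phi>) \<le> C^2 * norm (1 / t powr (2 * p))"
      using eventually_ge_at_top[of t0]
    proof eventually_elim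
      case (elim t)
      then have t: "t powr (2 * p) > 0" using assms(5) by simp
      have W: "\<Phi> (x t) - \<Phi> z \<ge> 0" using z(2) by simp
      then have "t powr (2 * p) * (\<Phi> (x t) - \<Phi> z) \<ge> 0" by simp
      then have "(\<Phi> (x t) - \<Phi> z) * t powr (2 * p) \<le> C^2"
        using E_ge(1)[of t] bound[OF elim] by (simp add: mult.commute)
      then show ?case using t W by (simp add: z(1) field_simps)
    qed
  qed
qed

end
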